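(* Let $\mathcal A,\mathcal B\subseteq\overline{\mathbb F}_q$ be Frobenius invariant sets, let $\diamond:\mathcal A\times\mathcal B\to\overline{\mathbb F}_q$ be a diamond product, let $m,n\ge 1$ be integers, and let $\alpha\in\mathcal A^{\mathrm p}_m$ and $\beta\in\mathcal B^{\mathrm p}_n$. Then $\diamond$ satisfies conjugate cancellation for $\alpha$ and $\beta$ if and only if for every $0\le j\le \gcd(m,n)-1$ \[\mathbb F_q(\alpha,\alpha\diamond\beta^{q^j})=\mathbb F_q(\beta,\alpha\diamond\beta^{q^j})=\mathbb F_q(\alpha,\beta).\] Equivalently, $\diamond$ satisfies conjugate cancellation for $\alpha$ and $\beta$ if and only if for every $0\le j\le\gcd(m,n)-1$ we have $\alpha\diamond\beta^{q^j}\in\mathcal F_q(r_j)$ with $r_j$ satisfying \[\operatorname{lcm}(m,n)=\operatorname{lcm}(n,r_j)=\operatorname{lcm}(m,r_j).\]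
   Context: Let $q$ be a prime power and $\overline{\mathbb F}_q$ an algebraic closure of $\mathbb F_q$, with $\mathbb F_{q^n}\subseteq\overline{\mathbb F}_q$. Put $\mathcal F_q(n)=\{\alpha\in\mathbb F_{q^n}:\mathbb F_q(\alpha)=\mathbb F_{q^n}\}$. A set $\mathcal A\subseteq\overline{\mathbb F}_q$ is Frobenius invariant if $\alpha^q\in\mathcal A$ for all $\alpha\in\mathcal A$; put $\mathcal A^{\mathrm p}_m=\mathcal A\cap\mathcal F_q(m)$ (similarly $\mathcal B^{\mathrm p}_n$). For Frobenius invariant $\mathcal A,\mathcal B$, a map $\diamond:\mathcal A\times\mathcal B\to\overline{\mathbb F}_q$ is a diamond product if $(\alpha\diamond\beta)^q=\alpha^q\diamond\beta^q$ for all $(\alpha,\beta)\in\mathcal A\times\mathcal B$. Conjugate cancellation: $\diamond$ satisfies conjugate cancellation on $\mathcal A^{\mathrm p}_m\times\mathcal B^{\mathrm p}_n$ if for every integer $k$ with $\gcd(m,n)\mid k$ and all $\alpha\in\mathcal A^{\mathrm p}_m$, $\beta\in\mathcal B^{\mathrm p}_n$: $\alpha\diamond\beta=\alpha^{q^k}\diamond\beta$ implies $\alpha=\alpha^{q^k}$, and $\alpha\diamond\beta=\alpha\diamond\beta^{q^k}$ implies $\beta=\beta^{q^k}$. (Here $x\mapsto x^{q^k}$ is the $k$-th power of the Frobenius automorphism.) It satisfies conjugate cancellation for a given $\alpha\in\mathcal A^{\mathrm p}_m$ and $\beta\in\mathcal B^{\mathrm p}_n$ if this holds with $\mathcal A,\mathcal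 B$ replaced by the conjugate sets $\{\alpha,\alpha^q,\dots,\alpha^{q^{m-1}}\}$ and $\{\beta,\beta^q,\dots,\beta^{q^{n-1}}\}$. *)

theory Defs
  imports "HOL-Algebra.Algebraic_Closure" "HOL-Algebra.Generated_Fields"
    "HOL-Number_Theory.Prime_Powers"
begin

text \<open>
  Throughout, \<open>K\<close> is the field with \<open>q\<close> elements, as a subfield of an algebraic closure \<open>L\<close>.
  The field obtained from \<open>K\<close> by adjoining the elements of \<open>S\<close> is \<open>generate_field L (K \<union> S)\<close>.
\<close>

text \<open>The unique subfield of \<open>L\<close> with \<open>q ^ n\<close> elements (only meaningful for \<open>n \<ge> 1\<close>).\<close>

definition subfield_of_order :: "('a, 'b) ring_scheme \<Rightarrow> nat \<Rightarrow> nat \<Rightarrow> 'a set" where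
  "subfield_of_order L q n = (THE F. subfield F L \<and> card F = q ^ n)"

definition primitive_elements :: "('a, 'b) ring_scheme \<Rightarrow> 'a set \<Rightarrow> nat \<Rightarrow> nat \<Rightarrow> 'a set" where
  "primitive_elements L K q n =
     {\<alpha> \<in> subfield_of_order L q n. generate_field L (K \<union> {\<alpha>}) = subfield_of_order L q n}"

definition frobenius_invariant :: "('a, 'b) ring_scheme \<Rightarrow> nat \<Rightarrow> 'a set \<Rightarrow> bool" where
  "frobenius_invariant L q A \<longleftrightarrow> A \<subseteq> carrier L \<and> (\<forall>\<alpha>\<in>A. \<alpha> [^]\<^bsub>L\<^esub> q \<in> A)"

definition primitive_part ::
    "('a, 'b) ring_scheme \<Rightarrow> 'a set \<Rightarrow> nat \<Rightarrow> 'a set \<Rightarrow> nat \<Rightarrow> 'a set" where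
  "primitive_part L K q A m = A \<inter> primitive_elements L K q m"

text \<open>
  A map \<open>A \<times> B \<rightarrow> L\<close> is represented by a curried total function, whose values outside
  \<open>A \<times> B\<close> are irrelevant.
\<close>

definition diamond_product ::
    "('a, 'b) ring_scheme \<Rightarrow> nat \<Rightarrow> 'a set \<Rightarrow> 'a set \<Rightarrow> ('a \<Rightarrow> 'a \<Rightarrow> 'a) \<Rightarrow> bool" where
  "diamond_product L q A B dia \<longleftrightarrow>
     (\<forall>\<alpha>\<in>A. \<forall>\<beta>\<in>B. dia \<alpha> \<beta> \<in> carrier L \<and>
        (dia \<alpha> \<beta>) [^]\<^bsub>L\<^esub> q = dia (\<alpha> [^]\<^bsub>L\<^esub> q) (\<beta> [^]\<^bsub>L\<^esub> q))"

text \<open>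
  The \<open>k\<close>-th power of the Frobenius automorphism of \<open>L\<close> for an arbitrary integer \<open>k\<close>;
  negative powers use that \<open>x \<mapsto> x [^] q\<close> is a bijection of the carrier.
\<close>

definition frobenius_power :: "('a, 'b) ring_scheme \<Rightarrow> nat \<Rightarrow> int \<Rightarrow> 'a \<Rightarrow> 'a" where
  "frobenius_power L q k x =
     (if 0 \<le> k then x [^]\<^bsub>L\<^esub> (q ^ nat k)
      else inv_into (carrier L) (\<lambda>y. y [^]\<^bsub>L\<^esub> (q ^ nat (- k))) x)"

definition conjugate_cancellation ::
    "('a, 'b) ring_scheme \<Rightarrow> 'a set \<Rightarrow> nat \<Rightarrow> ('a \<Rightarrow> 'a \<Rightarrow> 'a) \<Rightarrow>
     'a set \<Rightarrow> 'a set \<Rightarrow> nat \<Rightarrow> nat \<Rightarrow> bool" where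
  "conjugate_cancellation L K q dia A B m n \<longleftrightarrow>
     (\<forall>k::int. int (gcd m n) dvd k \<longrightarrow>
       (\<forall>\<alpha>\<in>primitive_part L K q A m. \<forall>\<beta>\<in>primitive_part L K q B n.
          (dia \<alpha> \<beta> = dia (frobenius_power L q k \<alpha>) \<beta> \<longrightarrow> \<alpha> = frobenius_power L q k \<alpha>) \<and>
          (dia \<alpha> \<beta> = dia \<alpha> (frobenius_power L q k \<beta>) \<longrightarrow> \<beta> = frobenius_power L q k \<beta>)))"

definition conjugates :: "('a, 'b) ring_scheme \<Rightarrow> nat \<Rightarrow> nat \<Rightarrow> 'a \<Rightarrow> 'a set" where
  "conjugates L q m \<alpha> = {\<alpha> [^]\<^bsub>L\<^esub> (q ^ i) | i. i < m}"

definition conjugate_cancellation_for ::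
    "('a, 'b) ring_scheme \<Rightarrow> 'a set \<Rightarrow> nat \<Rightarrow> ('a \<Rightarrow> 'a \<Rightarrow> 'a) \<Rightarrow>
     nat \<Rightarrow> nat \<Rightarrow> 'a \<Rightarrow> 'a \<Rightarrow> bool" where
  "conjugate_cancellation_for L K q dia m n \<alpha> \<beta> \<longleftrightarrow>
     conjugate_cancellation L K q dia (conjugates L q m \<alpha>) (conjugates L q n \<beta>) m n"

end

theory Submission
  imports Defs "HOL-Number_Theory.Cong"
begin

text \<open>
  Let \<open>\<sigma>\<close> be the Frobenius automorphism, \<open>F_d\<close> the field fixed by \<open>\<sigma>\<^sup>d\<close> and \<open>deg x\<close> the least positive \<open>d\<close> with
  \<open>x \<in> F_d\<close>. Then \<open>F_d\<close> is the only subfield with \<open>q ^ d\<close> elements, and adjoining \<open>x\<close> and \<open>y\<close> to the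
  base field gives \<open>F_d\<close> with \<open>d = lcm (deg x) (deg y)\<close>, so both criteria say that
  \<open>lcm n r_j = lcm m r_j = lcm m n\<close> for the degrees \<open>r_j\<close> of \<open>\<gamma>_j = \<alpha> \<diamond> \<sigma>\<^sup>j \<beta>\<close>.
  If cancellation holds and \<open>k = lcm n r_j\<close>, then \<open>\<sigma>\<^sup>k\<close> fixes \<open>\<gamma>_j\<close> and \<open>\<beta>\<close>, hence also \<open>\<alpha>\<close>, so \<open>m\<close> divides \<open>k\<close>.
  Conversely, by the Chinese remainder theorem every product of conjugates of \<open>\<alpha>\<close> and \<open>\<beta>\<close> is
  conjugate to some \<open>\<gamma>_j\<close>, and for \<open>gcd m n\<close> dividing \<open>k\<close> there is \<open>u\<close> with \<open>u \<equiv> k\<close> modulo \<open>m\<close> and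
  \<open>u \<equiv> 0\<close> modulo \<open>n\<close>: if moving only the first factor by \<open>\<sigma>\<^sup>k\<close> does not change the product, then
  \<open>\<sigma>\<^sup>u\<close> fixes the product, so \<open>lcm n r_j\<close>, and with it \<open>m\<close>, divides \<open>u\<close>.
\<close>

subsection \<open>Frobenius maps and finite subfields\<close>

text \<open>Induction by Pascal's rule: multiplying by \<open>x\<close> shifts the summation index,
  multiplying by \<open>y\<close> keeps it.\<close>

lemma (in cring) binomial:
  assumes x: "x \<in> carrier R" and y: "y \<in> carrier R"
  shows "(x \<oplus> y) [^] n = (\<Oplus>i\<in>{..n::nat}. [(n choose i)] \<cdot> (x [^] i \<otimes> y [^] (n - i)))"
proof (induction n)
  case 0
  then show ?case by simp
next
  case (Suc n)
  define t where "t = (\<lambda>n i. x [^] (i::nat) \<otimes> y [^] (n - i :: nat))"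
  have t: "t n i \<in> carrier R" for n i
    using x y by (simp add: t_def)
  have tx: "t n i \<otimes> x = t (Suc n) (Suc i)" for i
    using x y by (simp add: t_def m_ac)
  have ty: "t n i \<otimes> y = t (Suc n) i" if "i \<le> n" for i
    using x y that by (simp add: t_def m_ac Suc_diff_le)
  have "(x \<oplus> y) [^] Suc n = (\<Oplus>i\<in>{..n}. [(n choose i)] \<cdot> t n i) \<otimes> (x \<oplus> y)"
    using Suc by (simp add: t_def)
  also have "\<dots> = (\<Oplus>i\<in>{..n}. [(n choose i)] \<cdot> t n i) \<otimes> x \<oplus> (\<Oplus>i\<in>{..n}. [(n choose i)] \<cdot> t n i) \<otimes> y"
    using x y t by (intro r_distr) (auto intro: finsum_closed)
  also have "(\<Oplus>i\<in>{..n}. [(n choose i)] \<cdot> t n i) \<otimes> x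
      = (\<Oplus>i\<in>{..n}. [(n choose i)] \<cdot> t (Suc n) (Suc i))"
    using x t by (subst finsum_ldistr) (auto simp: add_pow_ldistr tx intro!: finsum_cong')
  also have "(\<Oplus>i\<in>{..n}. [(n choose i)] \<cdot> t n i) \<otimes> y = (\<Oplus>i\<in>{..n}. [(n choose i)] \<cdot> t (Suc n) i)"
    using y t by (subst finsum_ldistr) (auto simp: add_pow_ldistr ty intro!: finsum_cong')
  also have "\<dots> = (\<Oplus>i\<in>{..Suc n}. [(n choose i)] \<cdot> t (Suc n) i)"
    using t by (subst finsum_Suc) (auto simp: binomial_eq_0)
  also have "\<dots> = (\<Oplus>i\<in>{..n}. [(n choose Suc i)] \<cdot> t (Suc n) (Suc i)) \<oplus> t (Suc n) 0"
    using t by (subst finsum_Suc2) auto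
  also have "(\<Oplus>i\<in>{..n}. [(n choose i)] \<cdot> t (Suc n) (Suc i)) \<oplus> \<dots>
      = (\<Oplus>i\<in>{..n}. [(Suc n choose Suc i)] \<cdot> t (Suc n) (Suc i)) \<oplus> t (Suc n) 0"
    using t by (simp add: a_assoc [symmetric] finsum_addf [symmetric] add.nat_pow_mult)
  also have "\<dots> = (\<Oplus>i\<in>{..Suc n}. [(Suc n choose i)] \<cdot> t (Suc n) i)"
    using t by (subst finsum_Suc2) auto
  finally show ?case by (simp add: t_def)
qed

text \<open>The prime divides every inner binomial coefficient, so only the outer terms survive for
  exponent \<open>p\<close>; iteration gives \<open>p ^ k\<close>. The generality of commutative
  rings allows the use both in \<open>L\<close> and in its polynomial ring.\<close>

lemma (in cring) prime_power_add:
  fixes p k :: nat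
  assumes p: "prime p" and char: "[p] \<cdot> \<one> = \<zero>"
    and x: "x \<in> carrier R" and y: "y \<in> carrier R"
  shows "(x \<oplus> y) [^] (p ^ k) = x [^] (p ^ k) \<oplus> y [^] (p ^ k)"
proof -
  have zero: "[n] \<cdot> z = \<zero>" if n: "p dvd n" and z: "z \<in> carrier R" for n :: nat and z
  proof -
    obtain c where "n = p * c" using n by (elim dvdE)
    moreover have "[p] \<cdot> z = \<zero>"
      using add_pow_ldistr[of \<one> z p] char z by simp
    ultimately show ?thesis
      using add.nat_pow_pow[of z c p] z by simp
  qed
  have step: "(x \<oplus> y) [^] p = x [^] p \<oplus> y [^] p" if x: "x \<in> carrier R" and y: "y \<in> carrier R" for x y
  proof -
    let ?f = "\<lambda>i. [(p choose i)] \<cdot> (x [^] i \<otimes> y [^] (p - i))"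
    obtain n where n: "p = Suc (Suc n)"
      using prime_ge_2_nat[OF p] by (metis add_2_eq_Suc le_Suc_ex)
    have mid: "?f (Suc i) = \<zero>" if "i \<le> n" for i
      using x y that n by (intro zero dvd_choose_prime[OF _ _ _ p]) auto
    have "(x \<oplus> y) [^] p = (\<Oplus>i\<in>{..Suc (Suc n)}. ?f i)"
      using binomial[OF x y, of p] by (simp add: n)
    also have "\<dots> = ?f p \<oplus> (\<Oplus>i\<in>{..Suc n}. ?f i)"
      using x y by (subst finsum_Suc) (auto simp: n)
    also have "(\<Oplus>i\<in>{..Suc n}. ?f i) = (\<Oplus>i\<in>{..n}. ?f (Suc i)) \<oplus> ?f 0"
      using x y by (subst finsum_Suc2) auto
    also have "(\<Oplus>i\<in>{..n}. ?f (Suc i)) = \<zero>"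
      using mid by (intro add.finprod_one_eqI) auto
    finally show ?thesis using x y by simp
  qed
  show ?thesis
  proof (induction k)
    case (Suc k)
    have "(x \<oplus> y) [^] (p ^ Suc k) = ((x \<oplus> y) [^] (p ^ k)) [^] p"
      using x y by (simp add: nat_pow_pow mult.commute)
    also have "\<dots> = x [^] (p ^ Suc k) \<oplus> y [^] (p ^ Suc k)"
      using x y by (simp add: Suc step nat_pow_pow mult.commute)
    finally show ?case .
  qed (use x y in simp)
qed

section \<open>Cardinalities of finite fields\<close>

lemma (in field) finite_subfield_pow_card:
  assumes E: "subfield E R" and fin: "finite E" and x: "x \<in> E"
  shows "x [^] card E = x"
proof (cases "x = \<zero>")
  case True
  then show ?thesis
    using nat_pow_zero[of "card E"] card_gt_0_iff[of E] fin x by blast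
next
  case False
  interpret E: field "R\<lparr>carrier := E\<rparr>"
    using subfield_iff(2)[OF E] .
  interpret G: group "Multiplicative_Group.mult_of (R\<lparr>carrier := E\<rparr>)"
    by (rule E.field_mult_group)
  have pow: "y [^]\<^bsub>Multiplicative_Group.mult_of (R\<lparr>carrier := E\<rparr>)\<^esub> (k::nat) = y [^] k" for y k
    by (simp add: nat_pow_def)
  have "x [^] (card E - 1) = \<one>"
    using G.pow_order_eq_1[of x] E.order_mult_of fin x False
    by (simp add: pow order_def)
  moreover have "card E = Suc (card E - 1)"
    using card_gt_0_iff[of E] fin x by auto
  moreover have "x \<in> carrier R"
    using subfieldE(3)[OF E] x by blast
  ultimately show ?thesis
    by (metis l_one nat_pow_Suc)
qed

text \<open>Coordinates with respect to a basis identify \<open>E\<close> with the lists of length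
  \<open>d\<close> over \<open>K\<close>.\<close>

lemma (in field) card_finite_subfield_extension:
  assumes K: "subfield K R" and E: "subfield E R" and sub: "K \<subseteq> E" and fin: "finite E"
  obtains d where "d \<ge> 1" and "card E = card K ^ d"
proof -
  have Esub: "subgroup E (add_monoid R)"
    using subring.axioms(1)[OF subfieldE(1)[OF E]] .
  \<comment> \<open>The elements of \<open>E\<close>, listed, form a finite spanning family, so the
    dimension is finite.\<close>
  obtain xs where xs: "set xs = E"
    using finite_list[OF fin] by blast
  have xsc: "set xs \<subseteq> carrier R"
    using xs subfieldE(3)[OF E] by simp
  have "K <#> E \<subseteq> E"
    using subringE(6)[OF subfieldE(1)[OF E]] sub unfolding set_mult_def by blast
  then have "Span K xs \<subseteq> E"
    using Span_min[OF K xsc Esub] xs by simp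
  moreover have "E \<subseteq> Span K xs"
    using Span_base_incl[OF K xsc] xs by simp
  ultimately have "Span K xs = E" by blast
  then obtain d where dim: "dimension d K E"
    using Span_finite_dimension[OF K xsc] unfolding finite_dimension_def by auto
  obtain Us where Us: "independent K Us" "length Us = d" "Span K Us = E" "set Us \<subseteq> carrier R"
    using exists_base[OF K dim] by (elim exE conjE) (rule that)
  let ?L = "{Ks. set Ks \<subseteq> K \<and> length Ks = d}"
  have mem: "x \<in> E \<longleftrightarrow> (\<exists>Ks. set Ks \<subseteq> K \<and> length Ks = d \<and> x = combine Ks Us)" for x
    using Span_mem_iff_length_version[OF K Us(4), of x] unfolding Us(2,3) .
  have img: "combine Ks Us \<in> E" if "Ks \<in> ?L" for Ks
    unfolding mem using that by (intro exI[of _ Ks]) simp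
  have "bij_betw (\<lambda>Ks. combine Ks Us) ?L E"
  proof (intro bij_betwI')
    fix Ks Ks' assume Ks: "Ks \<in> ?L" "Ks' \<in> ?L"
    have "\<exists>!Ks'. set Ks' \<subseteq> K \<and> length Ks' = d \<and> combine Ks Us = combine Ks' Us"
      using unique_decomposition[OF K Us(1), of "combine Ks Us"] img[OF Ks(1)] unfolding Us(2,3) .
    then show "(combine Ks Us = combine Ks' Us) = (Ks = Ks')"
      using Ks by (elim ex1E) (metis (mono_tags, lifting) mem_Collect_eq)
  next
    fix x assume "x \<in> E"
    then show "\<exists>Ks\<in>?L. x = combine Ks Us"
      unfolding mem by blast
  qed (rule img)
  then have "card E = card ?L" by (simp add: bij_betw_same_card)
  then have card: "card E = card K ^ d"
    using card_lists_length_eq[OF finite_subset[OF sub fin]] by simp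
  \<comment> \<open>A field contains zero and one, whereas exponent \<open>0\<close> would leave a
    single element.\<close>
  have "card {\<zero>, \<one>} \<le> card E"
    using subringE(2,3)[OF subfieldE(1)[OF E]] fin by (intro card_mono) auto
  then have "d \<noteq> 0" using card by (intro notI) simp
  then show thesis using that[of d] card by simp
qed

lemma (in ring_hom_ring) hom_add_pow:
  "x \<in> carrier R \<Longrightarrow> h ([(n::nat)] \<cdot> x) = [n] \<cdot>\<^bsub>S\<^esub> h x"
  by (induction n) auto

text \<open>The elements counted are the roots of \<open>X ^ N - X\<close> with
  \<open>N = p ^ k\<close>. This polynomial splits, so it has \<open>N\<close> roots with
  multiplicity, and each of them is simple.\<close>

lemma (in algebraically_closed) card_roots_power_eq_self:
  fixes p k :: nat
  assumes p: "prime p" and char: "[p] \<cdot> \<one> = \<zero>" and k: "k \<ge> 1"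
  shows "card {x \<in> carrier L. x [^] (p ^ k) = x} = p ^ k"
proof -
  define N where "N = p ^ k"
  \<comment> \<open>The bound makes \<open>X ^ N\<close> dominate \<open>X\<close> in degree and
    keeps \<open>N - 1\<close> positive.\<close>
  have N: "N \<ge> 2"
    using prime_ge_2_nat[OF p] k self_le_power[of p k] unfolding N_def by simp
  let ?P = "poly_ring L"
  interpret P: domain ?P
    using univ_poly_is_domain[OF carrier_is_subring] .
  interpret c: ring_hom_ring L ?P poly_of_const
    using canonical_embedding_ring_hom[OF carrier_is_subring] by simp
  have charP: "[p] \<cdot>\<^bsub>?P\<^esub> \<one>\<^bsub>?P\<^esub> = \<zero>\<^bsub>?P\<^esub>"
    using c.hom_add_pow[of \<one> p] char by simp
  define f where "f = X [^]\<^bsub>?P\<^esub> N \<ominus>\<^bsub>?P\<^esub> X"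
  have X: "X \<in> carrier ?P"
    using var_closed(1)[OF carrier_is_subring] .
  have f: "f \<in> carrier ?P"
    using X unfolding f_def by simp
  have eval_f: "eval f x = \<zero> \<longleftrightarrow> x [^] N = x" if x: "x \<in> carrier L" for x
  proof -
    interpret e: ring_hom_ring ?P L "\<lambda>p. eval p x"
      by (intro ring_hom_ringI2 P.ring_axioms ring_axioms eval_is_hom[OF carrier_is_subring x])
    have "eval f x = x [^] N \<ominus> x"
      using X eval_var[OF x] e.hom_nat_pow[OF X, of N] by (simp add: f_def a_minus_def)
    then show ?thesis
      using r_right_minus_eq[of "x [^] N" x] x by simp
  qed
  have deg_X: "degree X = 1" by (simp add: var_def)
  have deg_f: "degree f = N"
  proof -
    have "degree (X [^]\<^bsub>?P\<^esub> N) = N"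
      using polynomial_pow_degree[OF X] deg_X by simp
    moreover have "degree (\<ominus>\<^bsub>?P\<^esub> X) = 1"
      using univ_poly_a_inv_degree[OF carrier_is_subring X] deg_X by simp
    ultimately show ?thesis
      using poly_add_degree_eq[OF carrier_is_subring, of "X [^]\<^bsub>?P\<^esub> N" "\<ominus>\<^bsub>?P\<^esub> X"] X N
      by (simp add: f_def a_minus_def univ_poly_add univ_poly_carrier)
  qed
  then have f_nz: "f \<noteq> []" using N by auto
  have roots: "x \<in># roots f \<longleftrightarrow> x \<in> carrier L \<and> x [^] N = x" for x
    using roots_mem_iff_is_root[OF f, of x] f_nz eval_f[of x] by (auto simp: is_root_def)
  \<comment> \<open>For a root \<open>a\<close>, additivity of the Frobenius map gives
    \<open>X ^ N - X = (X - a) ((X - a) ^ (N - 1) - 1)\<close>, so \<open>a\<close> is a simple root.\<close>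
  have simple: "count (roots f) a \<le> 1" for a
  proof (rule ccontr)
    assume "\<not> count (roots f) a \<le> 1"
    then have mult: "2 \<le> alg_mult f a" and "a \<in># roots f"
      using alg_mult_eq_count_roots[OF f] by (auto intro!: count_inI)
    then have a: "a \<in> carrier L" and aN: "a [^] N = a"
      using roots by auto
    define g where "g = [\<one>, \<ominus> a]"
    have g: "g \<in> carrier ?P"
      using a unfolding g_def sym[OF univ_poly_carrier] polynomial_def by auto
    let ?c = "poly_of_const a"
    have cc: "?c \<in> carrier ?P" using a by simp
    have X_eq: "X = g \<oplus>\<^bsub>?P\<^esub> ?c"
      using a by (auto simp: g_def var_def poly_of_const_def univ_poly_add l_neg)
    have "X [^]\<^bsub>?P\<^esub> N = g [^]\<^bsub>?P\<^esub> N \<oplus>\<^bsub>?P\<^esub> ?c"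
      using P.prime_power_add[OF p charP g cc, of k] c.hom_nat_pow[OF a, of N] aN
      unfolding X_eq N_def by simp
    then have "f = (g [^]\<^bsub>?P\<^esub> N \<oplus>\<^bsub>?P\<^esub> ?c) \<ominus>\<^bsub>?P\<^esub> (g \<oplus>\<^bsub>?P\<^esub> ?c)"
      unfolding f_def by (metis X_eq)
    also have "\<dots> = g [^]\<^bsub>?P\<^esub> N \<ominus>\<^bsub>?P\<^esub> g"
      using g cc P.nat_pow_closed[OF g, of N] by algebra
    also have "g [^]\<^bsub>?P\<^esub> N = g \<otimes>\<^bsub>?P\<^esub> g [^]\<^bsub>?P\<^esub> (N - 1)"
      using P.nat_pow_Suc2[OF g, of "N - 1"] N by simp
    finally have f_eq: "f = g \<otimes>\<^bsub>?P\<^esub> g [^]\<^bsub>?P\<^esub> (N - 1) \<ominus>\<^bsub>?P\<^esub> g" .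
    \<comment> \<open>At a double root one factor \<open>g\<close> cancels from
      \<open>f = g (g ^ (N - 1) - 1)\<close> while another remains on the left; evaluation at
      \<open>a\<close> then reads \<open>0 = 0 - 1\<close>.\<close>
    have "(g [^]\<^bsub>?P\<^esub> (2::nat)) pdivides f"
      using le_alg_mult_imp_pdivides[OF a f mult] by (simp add: g_def)
    then obtain h where h: "h \<in> carrier ?P" and "f = (g [^]\<^bsub>?P\<^esub> (2::nat)) \<otimes>\<^bsub>?P\<^esub> h"
      unfolding pdivides_def factor_def by auto
    then have "g \<otimes>\<^bsub>?P\<^esub> (g \<otimes>\<^bsub>?P\<^esub> h) = g \<otimes>\<^bsub>?P\<^esub> (g [^]\<^bsub>?P\<^esub> (N - 1) \<ominus>\<^bsub>?P\<^esub> \<one>\<^bsub>?P\<^esub>)"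
      using f_eq g P.nat_pow_closed[OF g, of "N - 1"]
      by (simp add: numeral_2_eq_2 P.m_assoc P.r_distr a_minus_def P.r_minus)
    then have "g \<otimes>\<^bsub>?P\<^esub> h = g [^]\<^bsub>?P\<^esub> (N - 1) \<ominus>\<^bsub>?P\<^esub> \<one>\<^bsub>?P\<^esub>"
      using P.m_lcancel[of g] g h by (simp add: g_def univ_poly_zero)
    then have eq: "eval (g \<otimes>\<^bsub>?P\<^esub> h) a = eval (g [^]\<^bsub>?P\<^esub> (N - 1) \<ominus>\<^bsub>?P\<^esub> \<one>\<^bsub>?P\<^esub>) a"
      by simp
    interpret e: ring_hom_ring ?P L "\<lambda>p. eval p a"
      by (intro ring_hom_ringI2 P.ring_axioms ring_axioms eval_is_hom[OF carrier_is_subring a])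
    have "eval g a = \<zero>"
      using a by (simp add: g_def r_neg)
    then have "eval (g \<otimes>\<^bsub>?P\<^esub> h) a = \<zero>"
      using e.hom_mult[OF g h] e.hom_closed[OF h] by simp
    moreover have "eval (g [^]\<^bsub>?P\<^esub> (N - 1)) a = \<zero>"
      using e.hom_nat_pow[OF g, of "N - 1"] \<open>eval g a = \<zero>\<close> N nat_pow_zero[of "N - 1"] by simp
    ultimately have "\<zero> = \<zero> \<ominus> \<one>"
      using eq g e.hom_one P.nat_pow_closed[OF g, of "N - 1"] by (simp add: a_minus_def)
    then have "\<zero> = \<one>"
      using r_right_minus_eq[of \<zero> \<one>] by simp
    then show False
      by simp
  qed
  have "size (roots f) = N"
    using roots_over_carrier[OF f] deg_f by (simp add: splitted_def)
  moreover have "roots f = mset_set (set_mset (roots f))"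
  proof (rule multiset_eqI)
    fix x
    show "count (roots f) x = count (mset_set (set_mset (roots f))) x"
      using simple[of x] by (cases "x \<in># roots f") (auto simp: le_Suc_eq count_eq_zero_iff)
  qed
  ultimately have "card (set_mset (roots f)) = N"
    by (metis size_mset_set)
  moreover have "set_mset (roots f) = {x \<in> carrier L. x [^] N = x}"
    using roots by auto
  ultimately show ?thesis by (simp add: N_def)
qed

lemma (in domain) nat_pow_eq_zero:
  assumes x: "x \<in> carrier R" and "x [^] (k::nat) = \<zero>"
  shows "x = \<zero>"
  using assms(2)
proof (induction k)
  case (Suc k)
  then have "x [^] k \<otimes> x = \<zero>" by simp
  then show ?case
    using integral[of "x [^] k" x] x Suc.IH by auto
qed simp

subsection \<open>Fixed fields of Frobenius powers\<close>

locale finite_field_closure = algebraic_closure L K for L (structure) and K +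
  fixes q :: nat
  assumes finite_base: "finite K" and card_base: "card K = q" and primepow_q: "primepow q"
begin

text \<open>For \<open>d = 0\<close> this is the whole carrier, which matches the convention that
  every number divides \<open>0\<close>.\<close>

definition frobenius_fixed :: "nat \<Rightarrow> 'a set" where
  "frobenius_fixed d = {x \<in> carrier L. x [^] (q ^ d) = x}"

lemma base_subfield: "subfield K L"
  by (rule subfield_axioms)

lemma frobenius_fixed_carrier: "x \<in> frobenius_fixed d \<Longrightarrow> x \<in> carrier L"
  by (simp add: frobenius_fixed_def)

lemma q_ge_2: "q \<ge> 2"
  using primepow_gt_Suc_0[OF primepow_q] by simp

text \<open>Lagrange's theorem in the additive group of \<open>K\<close> gives
  \<open>[q] \<cdot> \<one> = \<zero>\<close>. The left side is the \<open>e\<close>-th power of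
  \<open>[p] \<cdot> \<one>\<close>, and a domain has no nonzero nilpotents.\<close>

lemma characteristic:
  obtains p e where "prime (p::nat)" and "[p] \<cdot> \<one> = \<zero>" and "e \<ge> 1" and "q = p ^ e"
proof -
  obtain p e where p: "prime p" and "e > 0" and q: "q = p ^ e"
    using primepow_q unfolding primepow_def by blast
  then have e: "e \<ge> 1" by simp
  interpret K: field "L\<lparr>carrier := K\<rparr>"
    using subfield_iff(2)[OF base_subfield] .
  have pow_K: "y [^]\<^bsub>add_monoid (L\<lparr>carrier := K\<rparr>)\<^esub> k = [k] \<cdot> y" for y and k :: nat
    by (simp add: nat_pow_def add_pow_def)
  have "[q] \<cdot> \<one> = \<zero>"
    using K.add.pow_order_eq_1[of \<one>] subringE(3)[OF subfieldE(1)[OF base_subfield]] card_base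
    by (simp add: add_pow_def nat_pow_def order_def)
  have hom: "[(a * b)] \<cdot> \<one> = [a] \<cdot> \<one> \<otimes> [b] \<cdot> \<one>" for a b :: nat
    using add_pow_ldistr[of \<one> "[b] \<cdot> \<one>" a] add.nat_pow_pow[of \<one> a b] by (simp add: mult.commute)
  have "[(p ^ k)] \<cdot> \<one> = ([p] \<cdot> \<one>) [^] k" for k :: nat
    by (induction k) (simp_all add: hom m_comm)
  then have "([p] \<cdot> \<one>) [^] e = \<zero>"
    using \<open>[q] \<cdot> \<one> = \<zero>\<close> q by simp
  then have "[p] \<cdot> \<one> = \<zero>"
    using nat_pow_eq_zero[of "[p] \<cdot> \<one>"] by simp
  then show thesis using that p e q by blast
qed

lemma frobenius_add:
  assumes "x \<in> carrier L" and "y \<in> carrier L"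
  shows "(x \<oplus> y) [^] (q ^ d) = x [^] (q ^ d) \<oplus> y [^] (q ^ d)"
proof -
  obtain p e where "prime p" "[p] \<cdot> \<one> = \<zero>" "p ^ e = q"
    using characteristic by metis
  then show ?thesis
    using prime_power_add[of p x y "e * d"] assms by (simp add: power_mult)
qed

lemma frobenius_a_inv:
  assumes "x \<in> carrier L"
  shows "(\<ominus> x) [^] (q ^ d) = \<ominus> (x [^] (q ^ d))"
proof -
  have "(\<ominus> x) [^] (q ^ d) \<oplus> x [^] (q ^ d) = \<zero> [^] (q ^ d)"
    using frobenius_add[of "\<ominus> x" x d] assms by (simp add: l_neg)
  also have "\<dots> = \<zero>"
    using q_ge_2 by (intro nat_pow_zero) simp
  finally show ?thesis
    using minus_equality[of "(\<ominus> x) [^] (q ^ d)" "x [^] (q ^ d)"] assms by simp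
qed

lemma frobenius_inj:
  assumes "x \<in> carrier L" and "y \<in> carrier L" and "x [^] (q ^ d) = y [^] (q ^ d)"
  shows "x = y"
proof -
  have "(x \<oplus> \<ominus> y) [^] (q ^ d) = \<zero>"
    using assms frobenius_add[of x "\<ominus> y" d] frobenius_a_inv[of y d] by (simp add: r_neg)
  then have "x \<ominus> y = \<zero>"
    using assms nat_pow_eq_zero[of "x \<oplus> \<ominus> y"] by (simp add: a_minus_def)
  then show ?thesis
    using assms r_right_minus_eq by blast
qed

lemma frobenius_fixed_subfield: "subfield (frobenius_fixed d) L"
proof (rule subfieldI')
  show "subring (frobenius_fixed d) L"
    by (rule subringI)
      (auto simp: frobenius_fixed_def frobenius_add frobenius_a_inv nat_pow_distrib)
next
  fix k assume k: "k \<in> frobenius_fixed d - {\<zero>}"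
  then have kc: "k \<in> carrier L" "k \<in> Units L"
    by (auto simp: frobenius_fixed_def field_Units)
  \<comment> \<open>The image of \<open>inv k\<close> is again an inverse of \<open>k\<close>, so
    uniqueness of inverses shows that it is fixed.\<close>
  have "k \<otimes> (inv k) [^] (q ^ d) = k [^] (q ^ d) \<otimes> (inv k) [^] (q ^ d)"
    using k by (simp add: frobenius_fixed_def)
  also have "\<dots> = (k \<otimes> inv k) [^] (q ^ d)"
    using kc by (intro nat_pow_distrib [symmetric]) auto
  also have "\<dots> = \<one>"
    using kc by simp
  finally have "(inv k) [^] (q ^ d) = inv k"
    using kc by (metis Units_inv_closed comm_inv_char nat_pow_closed)
  then show "inv k \<in> frobenius_fixed d"
    using kc by (simp add: frobenius_fixed_def)
qed

text \<open>Since \<open>q ^ d = p ^ (e * d)\<close> is a power of the characteristic, the root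
  count applies.\<close>

lemma card_frobenius_fixed:
  assumes "d \<ge> 1"
  shows "card (frobenius_fixed d) = q ^ d"
proof -
  obtain p e where "prime p" "[p] \<cdot> \<one> = \<zero>" "e \<ge> 1" "p ^ e = q"
    using characteristic by metis
  then show ?thesis
    using card_roots_power_eq_self[of p "e * d"] assms
    by (simp add: power_mult frobenius_fixed_def)
qed

lemma finite_frobenius_fixed: "d \<ge> 1 \<Longrightarrow> finite (frobenius_fixed d)"
  using card_frobenius_fixed[of d] q_ge_2 by (intro card_ge_0_finite) simp

text \<open>Every element of a field with \<open>q ^ d\<close> elements equals its own
  \<open>q ^ d\<close>-th power, so \<open>E\<close> lies in the fixed field, which has the same
  finite size.\<close>

lemma subfield_eq_frobenius_fixed:
  assumes "d \<ge> 1" and E: "subfield E L" and card: "card E = q ^ d"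
  shows "E = frobenius_fixed d"
proof (rule card_subset_eq[OF finite_frobenius_fixed[OF assms(1)]])
  have "finite E" using card q_ge_2 by (intro card_ge_0_finite) simp
  then show "E \<subseteq> frobenius_fixed d"
    using finite_subfield_pow_card[OF E] subfieldE(3)[OF E] card
    by (auto simp: frobenius_fixed_def)
  show "card E = card (frobenius_fixed d)"
    using assms card_frobenius_fixed by simp
qed

lemma subfield_of_order_eq:
  assumes "d \<ge> 1"
  shows "subfield_of_order L q d = frobenius_fixed d"
  unfolding subfield_of_order_def
  using assms
  by (intro the_equality)
    (simp_all add: frobenius_fixed_subfield card_frobenius_fixed subfield_eq_frobenius_fixed)

lemma base_eq_frobenius_fixed: "K = frobenius_fixed 1"
  using subfield_eq_frobenius_fixed[OF _ base_subfield, of 1] card_base by simp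

lemma frobenius_iterate:
  assumes "x \<in> carrier L"
  shows "(x [^] (q ^ a)) [^] (q ^ b) = x [^] (q ^ (a + b))"
  using assms by (simp add: nat_pow_pow power_add)

lemma frobenius_fixed_mult:
  assumes "x \<in> frobenius_fixed d"
  shows "x [^] (q ^ (d * k)) = x"
  using assms
proof (induction k)
  case (Suc k)
  then have "x \<in> carrier L" "x [^] (q ^ d) = x" "x [^] (q ^ (d * k)) = x"
    by (auto simp: frobenius_fixed_def)
  then show ?case
    using frobenius_iterate[of x d "d * k"] by simp
qed (simp add: frobenius_fixed_def)

lemma frobenius_fixed_mod:
  assumes "x \<in> frobenius_fixed d"
  shows "x [^] (q ^ (k mod d)) = x [^] (q ^ k)"
  using frobenius_iterate[of x "d * (k div d)" "k mod d"] frobenius_fixed_mult[OF assms, of "k div d"]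
    frobenius_fixed_carrier[OF assms] by simp

lemma frobenius_fixed_mono: "d dvd e \<Longrightarrow> frobenius_fixed d \<subseteq> frobenius_fixed e"
  using frobenius_fixed_mult by (auto simp: frobenius_fixed_def elim!: dvdE)

text \<open>Euclid's algorithm on the exponents; the induction ends at exponent \<open>0\<close>,
  whose fixed field is the whole carrier.\<close>

lemma frobenius_fixed_gcd:
  "frobenius_fixed a \<inter> frobenius_fixed b \<subseteq> frobenius_fixed (gcd a b)"
proof (induction a b rule: gcd_nat_induct)
  case (step m n)
  have "x \<in> frobenius_fixed (m mod n)" if "x \<in> frobenius_fixed m" "x \<in> frobenius_fixed n" for x
    using that frobenius_fixed_mod[OF that(2), of m] by (simp add: frobenius_fixed_def)
  then show ?case
    using step by (auto simp: gcd_red_nat[of m n])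
qed auto

text \<open>An inclusion forces \<open>F_d\<close> into \<open>F_(gcd d e)\<close>, and comparing
  cardinalities gives \<open>d = gcd d e\<close>.\<close>

lemma frobenius_fixed_subset_iff:
  assumes d: "d \<ge> 1" and e: "e \<ge> 1"
  shows "frobenius_fixed d \<subseteq> frobenius_fixed e \<longleftrightarrow> d dvd e"
proof
  assume "frobenius_fixed d \<subseteq> frobenius_fixed e"
  then have "frobenius_fixed d \<subseteq> frobenius_fixed (gcd d e)"
    using frobenius_fixed_gcd by blast
  moreover have g: "gcd d e \<ge> 1" using d by (simp add: Suc_le_eq)
  ultimately have "q ^ d \<le> q ^ gcd d e"
    using card_mono[OF finite_frobenius_fixed] card_frobenius_fixed d by metis
  then have "d \<le> gcd d e"
    using q_ge_2 by simp
  then show "d dvd e"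
    using d gcd_le1_nat[of d e] by (metis gcd_dvd2 le_antisym not_one_le_zero)
qed (rule frobenius_fixed_mono)

lemma frobenius_fixed_eq_iff:
  assumes "d \<ge> 1" and "e \<ge> 1"
  shows "frobenius_fixed d = frobenius_fixed e \<longleftrightarrow> d = e"
  using assms by (auto simp: set_eq_subset frobenius_fixed_subset_iff intro: dvd_antisym)

lemma base_subset_frobenius_fixed: "K \<subseteq> frobenius_fixed d"
  using frobenius_fixed_mono[of 1 d] base_eq_frobenius_fixed by simp

section \<open>Degrees of elements and the fields they generate\<close>

text \<open>The \<open>LEAST\<close> is meaningful only for elements fixed by some positive power of the Frobenius
  automorphism, so the lemmas below assume such a power.\<close>

definition frobenius_degree :: "'a \<Rightarrow> nat" where
  "frobenius_degree x = (LEAST d. d \<ge> 1 \<and> x \<in> frobenius_fixed d)"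

lemma
  assumes "x \<in> frobenius_fixed e" and "e \<ge> 1"
  shows frobenius_degree_ge_1: "frobenius_degree x \<ge> 1"
    and frobenius_degree_fixed: "x \<in> frobenius_fixed (frobenius_degree x)"
  unfolding frobenius_degree_def
  using LeastI[of "\<lambda>d. d \<ge> 1 \<and> x \<in> frobenius_fixed d" e] assms by auto

text \<open>The gcd of the degree and \<open>k\<close> is again a positive exponent fixing
  \<open>x\<close>, so by minimality it is the degree itself.\<close>

lemma frobenius_fixed_iff_dvd:
  assumes "x \<in> frobenius_fixed e" and "e \<ge> 1"
  shows "x \<in> frobenius_fixed k \<longleftrightarrow> frobenius_degree x dvd k"
proof
  let ?d = "frobenius_degree x"
  have d: "?d \<ge> 1" "x \<in> frobenius_fixed ?d"
    using frobenius_degree_ge_1[OF assms] frobenius_degree_fixed[OF assms] by auto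
  assume "x \<in> frobenius_fixed k"
  then have "x \<in> frobenius_fixed (gcd ?d k)"
    using d frobenius_fixed_gcd by blast
  moreover have "gcd ?d k \<ge> 1" using d by (simp add: Suc_le_eq)
  ultimately have "?d \<le> gcd ?d k"
    unfolding frobenius_degree_def[of x] by (intro Least_le) simp
  then show "?d dvd k"
    using d gcd_le1_nat[of ?d k] by (metis gcd_dvd2 le_antisym not_one_le_zero)
next
  assume "frobenius_degree x dvd k"
  then show "x \<in> frobenius_fixed k"
    using frobenius_fixed_mono frobenius_degree_fixed[OF assms] by blast
qed

text \<open>The generated field is a finite extension of \<open>K\<close>, hence by its cardinality
  some \<open>F_d\<close>; containing \<open>x\<close> and \<open>y\<close> makes \<open>d\<close> a
  multiple of both degrees. The case \<open>y = x\<close> covers simple extensions.\<close>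

lemma generate_field_pair:
  assumes x: "x \<in> frobenius_fixed a" "a \<ge> 1" and y: "y \<in> frobenius_fixed b" "b \<ge> 1"
  shows "generate_field L (K \<union> {x, y}) = frobenius_fixed (lcm (frobenius_degree x) (frobenius_degree y))"
    (is "?G = frobenius_fixed ?l")
proof
  have l: "?l \<ge> 1"
    using frobenius_degree_ge_1[OF x] frobenius_degree_ge_1[OF y] by (simp add: Suc_le_eq lcm_pos_nat)
  have xl: "x \<in> frobenius_fixed ?l" and yl: "y \<in> frobenius_fixed ?l"
    using frobenius_fixed_iff_dvd[OF x] frobenius_fixed_iff_dvd[OF y] by auto
  have car: "K \<union> {x, y} \<subseteq> carrier L"
    using subfieldE(3)[OF base_subfield] xl yl by (auto simp: frobenius_fixed_def)
  show sub: "?G \<subseteq> frobenius_fixed ?l"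
    using xl yl base_subset_frobenius_fixed
    by (intro generate_field_min_subfield1[OF car frobenius_fixed_subfield]) auto
  have gen: "subfield ?G L" "K \<union> {x, y} \<subseteq> ?G"
    using generate_field_is_subfield[OF car] by (auto intro: generate_field.incl)
  moreover have "finite ?G"
    using sub finite_frobenius_fixed[OF l] finite_subset by blast
  ultimately obtain d where d: "d \<ge> 1" "card ?G = q ^ d"
    using card_finite_subfield_extension[OF base_subfield, of ?G] card_base by auto
  then have eq: "?G = frobenius_fixed d"
    using subfield_eq_frobenius_fixed gen(1) by blast
  then have "x \<in> frobenius_fixed d" "y \<in> frobenius_fixed d"
    using gen(2) by auto
  then have "?l dvd d"
    using frobenius_fixed_iff_dvd[OF x] frobenius_fixed_iff_dvd[OF y] by simp
  then show "frobenius_fixed ?l \<subseteq> ?G"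
    using frobenius_fixed_mono eq by simp
qed

text \<open>Membership in \<open>frobenius_fixed r\<close> supplies the positive power that makes
  the degree meaningful; then \<open>K(x)\<close> is \<open>F_d\<close> for \<open>d\<close> the
  degree of \<open>x\<close>.\<close>

lemma primitive_elements_iff:
  assumes "r \<ge> 1"
  shows "x \<in> primitive_elements L K q r \<longleftrightarrow> x \<in> frobenius_fixed r \<and> frobenius_degree x = r"
proof -
  have "generate_field L (K \<union> {x}) = frobenius_fixed r \<longleftrightarrow> frobenius_degree x = r"
    if x: "x \<in> frobenius_fixed r"
    using generate_field_pair[OF x assms x assms] frobenius_fixed_eq_iff[OF _ assms]
      frobenius_degree_ge_1[OF x assms] by simp
  then show ?thesis
    using assms by (auto simp: primitive_elements_def subfield_of_order_eq)
qed

section \<open>Conjugates and integer powers of the Frobenius automorphism\<close>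

lemma frobenius_conjugate_fixed_iff:
  assumes "x \<in> carrier L"
  shows "x [^] (q ^ i) \<in> frobenius_fixed k \<longleftrightarrow> x \<in> frobenius_fixed k"
proof -
  have "(x [^] (q ^ i)) [^] (q ^ k) = (x [^] (q ^ k)) [^] (q ^ i)"
    using assms by (simp add: frobenius_iterate add.commute)
  then show ?thesis
    using assms frobenius_inj[of "x [^] (q ^ k)" x i] by (auto simp: frobenius_fixed_def)
qed

lemma frobenius_degree_conjugate:
  "x \<in> carrier L \<Longrightarrow> frobenius_degree (x [^] (q ^ i)) = frobenius_degree x"
  by (simp add: frobenius_degree_def frobenius_conjugate_fixed_iff)

lemma frobenius_fixed_cong:
  assumes "x \<in> frobenius_fixed d" and "[i = j] (mod d)"
  shows "x [^] (q ^ i) = x [^] (q ^ j)"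
  using frobenius_fixed_mod[OF assms(1)] assms(2) unfolding cong_def by metis

lemma conjugate_eq_iff_dvd:
  assumes x: "x \<in> frobenius_fixed d" "d \<ge> 1"
  shows "x [^] (q ^ i) = x [^] (q ^ (i + k)) \<longleftrightarrow> frobenius_degree x dvd k"
proof -
  have xc: "x \<in> carrier L" using x by (simp add: frobenius_fixed_def)
  then have "x [^] (q ^ i) = x [^] (q ^ (i + k)) \<longleftrightarrow> x [^] (q ^ i) \<in> frobenius_fixed k"
    by (auto simp: frobenius_fixed_def frobenius_iterate)
  then show ?thesis
    using frobenius_conjugate_fixed_iff[OF xc] frobenius_fixed_iff_dvd[OF x] by simp
qed

text \<open>On elements of finite degree an inverse power agrees with a nonnegative one, so all
  exponents can be taken natural.\<close>

lemma frobenius_power_eq: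
  assumes x: "x \<in> frobenius_fixed d" and d: "d \<ge> 1"
  shows "frobenius_power L q k x = x [^] (q ^ nat (k mod int d))"
proof (cases "0 \<le> k")
  case True
  then have "nat (k mod int d) = nat k mod d"
    by (simp add: nat_mod_distrib)
  then show ?thesis
    using True frobenius_fixed_mod[OF x] by (simp add: frobenius_power_def)
next
  case False
  define t c where "t = nat (k mod int d)" and "c = nat (- k)"
  have xc: "x \<in> carrier L" using x by (simp add: frobenius_fixed_def)
  \<comment> \<open>As a multiple of \<open>d\<close>, the exponent \<open>t + c\<close> fixes
    \<open>x\<close>; hence the \<open>t\<close>-th conjugate is the unique preimage of
    \<open>x\<close> under the \<open>c\<close>-th power.\<close>
  have "int (t + c) = k mod int d - k"
    using False d by (simp add: t_def c_def)
  then have "int d dvd int (t + c)"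
    by (simp add: mod_eq_dvd_iff [symmetric])
  then have "d dvd t + c"
    by (simp only: int_dvd_int_iff)
  then have "(x [^] (q ^ t)) [^] (q ^ c) = x"
    using frobenius_fixed_mult[OF x] xc by (auto simp: frobenius_iterate elim!: dvdE)
  moreover have "inj_on (\<lambda>y. y [^] (q ^ c)) (carrier L)"
    by (intro inj_onI) (rule frobenius_inj)
  ultimately have "inv_into (carrier L) (\<lambda>y. y [^] (q ^ c)) x = x [^] (q ^ t)"
    using xc by (intro inv_into_f_eq) auto
  then show ?thesis
    using False by (simp add: frobenius_power_def t_def c_def)
qed

text \<open>All conjugates have the same degree, so the intersection discards none of them;
  periodicity of the exponents permits an unbounded index.\<close>

lemma primitive_part_conjugates:
  assumes x: "x \<in> frobenius_fixed d" "frobenius_degree x = d" and d: "d \<ge> 1"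
  shows "primitive_part L K q (conjugates L q d x) d = range (\<lambda>i. x [^] (q ^ i))"
proof -
  have xc: "x \<in> carrier L" using x by (simp add: frobenius_fixed_def)
  have "x [^] (q ^ i) \<in> conjugates L q d x" for i
    using frobenius_fixed_mod[OF x(1), of i, symmetric] d unfolding conjugates_def
    by (auto intro!: exI[of _ "i mod d"])
  moreover have "x [^] (q ^ i) \<in> primitive_elements L K q d" for i
    using x d xc by (simp add: primitive_elements_iff frobenius_conjugate_fixed_iff frobenius_degree_conjugate)
  ultimately show ?thesis
    by (auto simp: primitive_part_def conjugates_def)
qed

lemma frobenius_invariant_iterate:
  assumes S: "frobenius_invariant L q S" and "x \<in> S"
  shows "x [^] (q ^ i) \<in> S"
proof (induction i)
  case (Suc i)
  have "x \<in> carrier L"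
    using assms by (auto simp: frobenius_invariant_def)
  then have "(x [^] (q ^ i)) [^] q = x [^] (q ^ Suc i)"
    using frobenius_iterate[of x i 1] by simp
  then show ?case
    using S Suc by (metis frobenius_invariant_def)
qed (use assms in \<open>auto simp: frobenius_invariant_def\<close>)

end

subsection \<open>Conjugate cancellation\<close>

text \<open>The Chinese remainder theorem for moduli that need not be coprime, with solution
  \<open>i + m * x * c\<close> for a Bezout coefficient \<open>x\<close>.\<close>

lemma chinese_remainder_gcd_nat:
  fixes m n i j :: nat
  assumes "m \<ge> 1" and "n \<ge> 1" and "[i = j] (mod gcd m n)"
  obtains s where "[s = i] (mod m)" and "[s = j] (mod n)"
proof -
  obtain x where x: "[m * x = gcd m n] (mod n)"
    using cong_solve_nat[of m n] assms(1) by auto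
  \<comment> \<open>Adding \<open>n * i\<close> keeps the residue modulo \<open>n\<close> and
    ensures that \<open>j' - i\<close> does not truncate.\<close>
  define j' where "j' = j + n * i"
  have "i \<le> j'" using assms(2) by (simp add: j'_def trans_le_add2)
  have "[i = j'] (mod gcd m n)"
    using assms(3) by (auto simp: j'_def cong_def mod_add_right_eq [symmetric] mod_mult_left_eq [symmetric]
      intro: cong_trans)
  then have "gcd m n dvd j' - i"
    using \<open>i \<le> j'\<close> cong_altdef_nat cong_sym by blast
  then obtain c where c: "j' - i = gcd m n * c" by (elim dvdE)
  have "[i + m * x * c = i + gcd m n * c] (mod n)"
    using x by (intro cong_add cong_mult) auto
  also have "i + gcd m n * c = j'"
    using c \<open>i \<le> j'\<close> by simp
  also have "[j' = j] (mod n)"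
    by (simp add: j'_def cong_def)
  finally have "[i + m * x * c = j] (mod n)" .
  moreover have "[i + m * x * c = i] (mod m)"
    by (simp add: cong_def mult.assoc)
  ultimately show thesis using that by blast
qed

locale diamond_pair = finite_field_closure +
  fixes A B :: "'a set" and dia :: "'a \<Rightarrow> 'a \<Rightarrow> 'a" and m n :: nat and \<alpha> \<beta> :: 'a
  assumes invariant_A: "frobenius_invariant L q A" and invariant_B: "frobenius_invariant L q B"
    and diamond: "diamond_product L q A B dia"
    and m: "m \<ge> 1" and n: "n \<ge> 1"
    and alpha_mem: "\<alpha> \<in> primitive_part L K q A m" and beta_mem: "\<beta> \<in> primitive_part L K q B n"
begin

text \<open>Indexing by exponents turns the problem into arithmetic: only \<open>i\<close> modulo
  \<open>m\<close> and \<open>j\<close> modulo \<open>n\<close> matter, and Frobenius raises both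
  indices by one.\<close>

definition conj_diamond :: "nat \<Rightarrow> nat \<Rightarrow> 'a" where
  "conj_diamond i j = dia (\<alpha> [^] (q ^ i)) (\<beta> [^] (q ^ j))"

lemma alpha: "\<alpha> \<in> A" "\<alpha> \<in> frobenius_fixed m" "frobenius_degree \<alpha> = m"
  using alpha_mem m by (auto simp: primitive_part_def primitive_elements_iff)

lemma beta: "\<beta> \<in> B" "\<beta> \<in> frobenius_fixed n" "frobenius_degree \<beta> = n"
  using beta_mem n by (auto simp: primitive_part_def primitive_elements_iff)

lemma conj_diamond_carrier: "conj_diamond i j \<in> carrier L"
  using diamond frobenius_invariant_iterate[OF invariant_A alpha(1), of i]
    frobenius_invariant_iterate[OF invariant_B beta(1), of j]
  by (simp add: diamond_product_def conj_diamond_def)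

lemma conj_diamond_frobenius: "conj_diamond i j [^] (q ^ k) = conj_diamond (i + k) (j + k)"
proof (induction k)
  case 0
  then show ?case using conj_diamond_carrier by simp
next
  case (Suc k)
  have c: "\<alpha> \<in> carrier L" "\<beta> \<in> carrier L"
    using alpha(2) beta(2) by (auto simp: frobenius_fixed_def)
  have "conj_diamond i j [^] (q ^ Suc k) = conj_diamond (i + k) (j + k) [^] q"
    using frobenius_iterate[OF conj_diamond_carrier, of i j k 1] Suc by simp
  also have "\<dots> = dia ((\<alpha> [^] (q ^ (i + k))) [^] q) ((\<beta> [^] (q ^ (j + k))) [^] q)"
    using diamond frobenius_invariant_iterate[OF invariant_A alpha(1), of "i + k"]
      frobenius_invariant_iterate[OF invariant_B beta(1), of "j + k"]
    by (simp add: diamond_product_def conj_diamond_def)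
  also have "\<dots> = conj_diamond (i + Suc k) (j + Suc k)"
    using frobenius_iterate[OF c(1), of "i + k" 1] frobenius_iterate[OF c(2), of "j + k" 1]
    by (simp add: conj_diamond_def)
  finally show ?case .
qed

lemma conj_diamond_cong:
  assumes "[i = i'] (mod m)" and "[j = j'] (mod n)"
  shows "conj_diamond i j = conj_diamond i' j'"
  using frobenius_fixed_cong[OF alpha(2) assms(1)] frobenius_fixed_cong[OF beta(2) assms(2)]
  by (simp add: conj_diamond_def)

lemma conj_diamond_fixed: "conj_diamond i j \<in> frobenius_fixed (lcm m n)"
proof -
  have "conj_diamond (i + lcm m n) (j + lcm m n) = conj_diamond i j"
    by (intro conj_diamond_cong) (auto simp: cong_def mod_add_right_eq [symmetric])
  then show ?thesis
    using conj_diamond_carrier conj_diamond_frobenius by (simp add: frobenius_fixed_def)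
qed

lemma lcm_ge_1: "lcm m n \<ge> 1"
  using m n by (simp add: Suc_le_eq lcm_pos_nat)

lemma conj_diamond_fixed_iff:
  "conj_diamond i j = conj_diamond (i + k) (j + k) \<longleftrightarrow> frobenius_degree (conj_diamond i j) dvd k"
  using frobenius_fixed_iff_dvd[OF conj_diamond_fixed lcm_ge_1, of i j k] conj_diamond_carrier
    conj_diamond_frobenius by (auto simp: frobenius_fixed_def)

text \<open>Both elements are fixed by the \<open>m * n\<close>-th power of Frobenius, so an integer
  \<open>k\<close> may be replaced by its residue modulo \<open>m * n\<close>.\<close>

lemma cancellation_iff:
  "conjugate_cancellation_for L K q dia m n \<alpha> \<beta> \<longleftrightarrow>
    (\<forall>k i j. gcd m n dvd k \<longrightarrow>
      (conj_diamond i j = conj_diamond (i + k) j \<longrightarrow> m dvd k) \<and>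
      (conj_diamond i j = conj_diamond i (j + k) \<longrightarrow> n dvd k))" (is "_ \<longleftrightarrow> ?R")
proof -
  let ?P = "\<lambda>k i j.
      (conj_diamond i j = conj_diamond (i + k) j \<longrightarrow> m dvd k) \<and>
      (conj_diamond i j = conj_diamond i (j + k) \<longrightarrow> n dvd k)"
  let ?k = "\<lambda>k. nat (k mod int (m * n))"
  have mn: "m * n \<ge> 1" using m n by simp
  have c: "\<alpha> \<in> carrier L" "\<beta> \<in> carrier L"
    using alpha(2) beta(2) by (auto simp: frobenius_fixed_def)
  have "\<alpha> \<in> frobenius_fixed (m * n)" "\<beta> \<in> frobenius_fixed (m * n)"
    using alpha(2) beta(2) frobenius_fixed_mono[of m "m * n"] frobenius_fixed_mono[of n "m * n"] by auto
  then have pow: "frobenius_power L q k (\<alpha> [^] (q ^ i)) = \<alpha> [^] (q ^ (i + ?k k))"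
      "frobenius_power L q k (\<beta> [^] (q ^ i)) = \<beta> [^] (q ^ (i + ?k k))" for k i
    using frobenius_power_eq[OF _ mn] c by (simp_all add: frobenius_conjugate_fixed_iff frobenius_iterate)
  have "conjugate_cancellation_for L K q dia m n \<alpha> \<beta> \<longleftrightarrow>
      (\<forall>k::int. int (gcd m n) dvd k \<longrightarrow> (\<forall>i j. ?P (?k k) i j))"
    unfolding conjugate_cancellation_for_def conjugate_cancellation_def
      primitive_part_conjugates[OF alpha(2,3) m] primitive_part_conjugates[OF beta(2,3) n]
    using conjugate_eq_iff_dvd[OF alpha(2) m] conjugate_eq_iff_dvd[OF beta(2) n] alpha(3) beta(3)
    by (simp add: pow conj_diamond_def)
  also have "\<dots> \<longleftrightarrow> ?R"
  proof
    assume L: "\<forall>k::int. int (gcd m n) dvd k \<longrightarrow> (\<forall>i j. ?P (?k k) i j)"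
    have "?P k i j" if k: "gcd m n dvd k" for k i j
    proof -
      let ?r = "k mod (m * n)"
      have "?P ?r i j"
        using L[rule_format, of "int k" i j] k by (simp add: zmod_int [symmetric] del: of_nat_mult)
      moreover have "[k = ?r] (mod m)" "[k = ?r] (mod n)"
        by (simp_all add: cong_def mod_mod_cancel)
      moreover from this have "conj_diamond (i + k) j = conj_diamond (i + ?r) j"
        "conj_diamond i (j + k) = conj_diamond i (j + ?r)"
        by (auto intro!: conj_diamond_cong cong_add)
      ultimately show ?thesis
        using cong_dvd_iff by metis
    qed
    then show ?R by blast
  next
    assume R: ?R
    show "\<forall>k::int. int (gcd m n) dvd k \<longrightarrow> (\<forall>i j. ?P (?k k) i j)"
    proof (intro allI impI)
      fix k :: int and i j
      assume "int (gcd m n) dvd k"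
      \<comment> \<open>Because the gcd divides \<open>m * n\<close>, the reduced exponent is still
        a multiple of it.\<close>
      moreover have "int (gcd m n) dvd int (m * n)"
        by (simp only: int_dvd_int_iff) simp
      ultimately have "int (gcd m n) dvd int (?k k)"
        using mn by (simp add: dvd_mod del: of_nat_mult)
      then have "gcd m n dvd ?k k"
        by (simp only: int_dvd_int_iff)
      then show "?P (?k k) i j"
        using R by blast
    qed
  qed
  finally show ?thesis .
qed

text \<open>The pairs \<open>(0, j)\<close> with \<open>j < gcd m n\<close> suffice, since they meet
  every Frobenius orbit of products of conjugates.\<close>

lemma cancellation_iff_degree:
  "conjugate_cancellation_for L K q dia m n \<alpha> \<beta> \<longleftrightarrow>
    (\<forall>j < gcd m n. lcm n (frobenius_degree (conj_diamond 0 j)) = lcm m n \<and>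
      lcm m (frobenius_degree (conj_diamond 0 j)) = lcm m n)" (is "?C \<longleftrightarrow> ?R")
proof
  assume C: ?C
  \<comment> \<open>Multiples of \<open>n\<close> are admissible exponents for cancellation, and
    shifting the second index by one of them changes nothing.\<close>
  have canc: "m dvd k" if "n dvd k" and "conj_diamond i j = conj_diamond (i + k) j" for i j k
    using C that dvd_trans[OF gcd_dvd2 that(1)] unfolding cancellation_iff by blast
  have canc': "n dvd k" if "m dvd k" and "conj_diamond i j = conj_diamond i (j + k)" for i j k
    using C that dvd_trans[OF gcd_dvd1 that(1)] unfolding cancellation_iff by blast
  show ?R
  proof (intro allI impI)
    fix j
    let ?r = "frobenius_degree (conj_diamond 0 j)"
    have r: "?r dvd lcm m n"
      using frobenius_fixed_iff_dvd[OF conj_diamond_fixed lcm_ge_1] conj_diamond_fixed by blast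
    \<comment> \<open>The exponent \<open>lcm n ?r\<close> fixes the product because
      \<open>?r\<close> divides it, and its effect on the second index disappears modulo
      \<open>n\<close>.\<close>
    have "conj_diamond 0 j = conj_diamond (0 + lcm n ?r) (j + lcm n ?r)"
      by (simp only: conj_diamond_fixed_iff dvd_lcm2)
    also have "\<dots> = conj_diamond (0 + lcm n ?r) j"
      by (intro conj_diamond_cong) (auto simp: cong_def mod_add_right_eq [symmetric])
    finally have "m dvd lcm n ?r"
      by (intro canc[of _ 0 j]) auto
    moreover have "conj_diamond 0 j = conj_diamond (0 + lcm m ?r) (j + lcm m ?r)"
      by (simp only: conj_diamond_fixed_iff dvd_lcm2)
    then have "conj_diamond 0 j = conj_diamond 0 (j + lcm m ?r)"
      using conj_diamond_cong[of "0 + lcm m ?r" 0 "j + lcm m ?r" "j + lcm m ?r"]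
      by (simp add: cong_def)
    then have "n dvd lcm m ?r"
      by (intro canc'[of _ 0 j]) auto
    ultimately show "lcm n ?r = lcm m n \<and> lcm m ?r = lcm m n"
      using r by (auto intro!: dvd_antisym)
  qed
next
  assume R: ?R
  \<comment> \<open>Here \<open>t\<close> is \<open>j - i\<close> modulo the gcd, and
    \<open>s\<close> solves \<open>s = i\<close> modulo \<open>m\<close> and
    \<open>t + s = j\<close> modulo \<open>n\<close>; Frobenius to the power \<open>s\<close> then
    moves the pair \<open>(0, t)\<close> to \<open>(i, j)\<close>.\<close>
  have deg: "\<exists>t < gcd m n. frobenius_degree (conj_diamond i j) = frobenius_degree (conj_diamond 0 t)" for i j
  proof -
    define g where "g = gcd m n"
    have g: "g \<ge> 1" using m by (simp add: g_def Suc_le_eq)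
    \<comment> \<open>The summand \<open>g * i\<close> prevents truncated subtraction;
      \<open>n * t\<close> serves the same purpose below.\<close>
    define t where "t = (j + g * i - i) mod g"
    have "i \<le> g * i" using g by simp
    have "[i + t = i + (j + g * i - i)] (mod g)"
      unfolding t_def by (intro cong_add) (auto simp: cong_def)
    also have "i + (j + g * i - i) = j + g * i"
      using \<open>i \<le> g * i\<close> by linarith
    also have "[j + g * i = j] (mod g)" by (simp add: cong_def)
    finally have it: "[i + t = j] (mod g)" .
    have "t \<le> n * t" using n by simp
    have "[j = j + n * t] (mod g)"
      by (rule cong_dvd_modulus_nat[of _ _ n]) (simp_all add: cong_def g_def)
    with it have "[i + t = j + n * t] (mod g)"
      by (rule cong_trans)
    also have "j + n * t = (j + n * t - t) + t"
      using \<open>t \<le> n * t\<close> by linarith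
    finally have "[i + t = (j + n * t - t) + t] (mod g)" .
    then have "[i = j + n * t - t] (mod g)"
      by (simp only: cong_add_rcancel_nat)
    then obtain s where s: "[s = i] (mod m)" "[s = j + n * t - t] (mod n)"
      using chinese_remainder_gcd_nat[OF m n] unfolding g_def by blast
    have "[t + s = t + (j + n * t - t)] (mod n)"
      using s(2) by (intro cong_add) auto
    also have "t + (j + n * t - t) = j + n * t"
      using \<open>t \<le> n * t\<close> by linarith
    also have "[j + n * t = j] (mod n)" by (simp add: cong_def)
    finally have "conj_diamond (0 + s) (t + s) = conj_diamond i j"
      using s(1) by (intro conj_diamond_cong) auto
    then have "conj_diamond i j = conj_diamond 0 t [^] (q ^ s)"
      by (simp only: conj_diamond_frobenius)
    then have "frobenius_degree (conj_diamond i j) = frobenius_degree (conj_diamond 0 t)"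
      using frobenius_degree_conjugate[OF conj_diamond_carrier] by simp
    moreover have "t < g" using g by (simp add: t_def)
    ultimately show ?thesis unfolding g_def by blast
  qed
  have lcms: "lcm n (frobenius_degree (conj_diamond i j)) = lcm m n"
      "lcm m (frobenius_degree (conj_diamond i j)) = lcm m n" for i j
    using deg[of i j] R by auto
  show ?C
    unfolding cancellation_iff
  proof (intro allI impI conjI)
    fix k i j assume k: "gcd m n dvd k" and eq: "conj_diamond i j = conj_diamond (i + k) j"
    \<comment> \<open>Shifting both indices by \<open>u\<close> amounts to shifting only the first
      by \<open>k\<close>, so the assumed equality says that the \<open>u\<close>-th power of
      Frobenius fixes the product.\<close>
    obtain u where u: "[u = k] (mod m)" "[u = 0] (mod n)"
      using chinese_remainder_gcd_nat[OF m n, of k 0] k by (auto simp: cong_0_iff)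
    have "conj_diamond (i + k) j = conj_diamond (i + u) (j + u)"
      using u(1) cong_add[OF cong_refl u(2), of j] by (intro conj_diamond_cong cong_add) (auto intro: cong_sym)
    then have "frobenius_degree (conj_diamond i j) dvd u"
      using eq conj_diamond_fixed_iff by simp
    moreover have "n dvd u" using u(2) by (simp add: cong_0_iff)
    ultimately have "lcm n (frobenius_degree (conj_diamond i j)) dvd u" by simp
    then have "m dvd u" unfolding lcms by simp
    then show "m dvd k" using u(1) cong_dvd_iff by blast
  next
    fix k i j assume k: "gcd m n dvd k" and eq: "conj_diamond i j = conj_diamond i (j + k)"
    \<comment> \<open>The mirror image: \<open>u\<close> acts as \<open>k\<close> on the second
      index and trivially on the first.\<close>
    obtain u where u: "[u = 0] (mod m)" "[u = k] (mod n)"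
      using chinese_remainder_gcd_nat[OF m n, of 0 k] k by (auto simp: cong_0_iff cong_sym_eq[of 0])
    have "conj_diamond i (j + k) = conj_diamond (i + u) (j + u)"
      using u(2) cong_add[OF cong_refl u(1), of i] by (intro conj_diamond_cong cong_add) (auto intro: cong_sym)
    then have "frobenius_degree (conj_diamond i j) dvd u"
      using eq conj_diamond_fixed_iff by simp
    moreover have "m dvd u" using u(1) by (simp add: cong_0_iff)
    ultimately have "lcm m (frobenius_degree (conj_diamond i j)) dvd u" by simp
    then have "n dvd u" unfolding lcms by simp
    then show "n dvd k" using u(2) cong_dvd_iff by blast
  qed
qed

lemma conj_diamond_0: "dia \<alpha> (\<beta> [^] (q ^ j)) = conj_diamond 0 j"
  using alpha(2) by (simp add: conj_diamond_def frobenius_fixed_def)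

text \<open>Each generated field is \<open>F_l\<close> for an lcm \<open>l\<close> of two degrees,
  and for positive exponents such fields agree exactly when the exponents do.\<close>

lemma cancellation_iff_fields:
  "conjugate_cancellation_for L K q dia m n \<alpha> \<beta> \<longleftrightarrow>
    (\<forall>j < gcd m n.
       generate_field L (K \<union> {\<alpha>, dia \<alpha> (\<beta> [^] (q ^ j))}) = generate_field L (K \<union> {\<alpha>, \<beta>}) \<and>
       generate_field L (K \<union> {\<beta>, dia \<alpha> (\<beta> [^] (q ^ j))}) = generate_field L (K \<union> {\<alpha>, \<beta>}))"
proof -
  have r: "frobenius_degree (conj_diamond 0 j) \<ge> 1" for j
    using frobenius_degree_ge_1[OF conj_diamond_fixed lcm_ge_1] .
  have "lcm d (frobenius_degree (conj_diamond 0 j)) \<ge> 1" if "d \<ge> 1" for d j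
    using that r[of j] by (simp add: Suc_le_eq lcm_pos_nat)
  then show ?thesis
    unfolding cancellation_iff_degree conj_diamond_0
      generate_field_pair[OF alpha(2) m conj_diamond_fixed lcm_ge_1]
      generate_field_pair[OF beta(2) n conj_diamond_fixed lcm_ge_1]
      generate_field_pair[OF alpha(2) m beta(2) n] alpha(3) beta(3)
    using m n lcm_ge_1 by (auto simp: frobenius_fixed_eq_iff)
qed

text \<open>The existential has exactly one candidate, since primitivity forces \<open>r\<close> to
  be the degree of the product.\<close>

lemma cancellation_iff_lcm:
  "conjugate_cancellation_for L K q dia m n \<alpha> \<beta> \<longleftrightarrow>
    (\<forall>j < gcd m n. \<exists>r \<ge> 1. dia \<alpha> (\<beta> [^] (q ^ j)) \<in> primitive_elements L K q r \<and>
       lcm m n = lcm n r \<and> lcm n r = lcm m r)"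
proof -
  have "(\<exists>r \<ge> 1. conj_diamond 0 j \<in> primitive_elements L K q r \<and> P r) \<longleftrightarrow>
      P (frobenius_degree (conj_diamond 0 j))" for j P
    using frobenius_degree_ge_1[OF conj_diamond_fixed lcm_ge_1, of 0 j]
      frobenius_degree_fixed[OF conj_diamond_fixed lcm_ge_1, of 0 j]
    by (auto simp: primitive_elements_iff)
  then show ?thesis
    unfolding cancellation_iff_degree conj_diamond_0 by auto
qed

end

theorem theorem2p5:
  fixes L :: "('a, 'b) ring_scheme" and K A B :: "'a set"
    and dia :: "'a \<Rightarrow> 'a \<Rightarrow> 'a" and q m n :: nat and \<alpha> \<beta> :: 'a
  assumes "primepow q"
    and "algebraic_closure L K" and "finite K" and "card K = q"
    and "frobenius_invariant L q A" and "frobenius_invariant L q B"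
    and "diamond_product L q A B dia"
    and "m \<ge> 1" and "n \<ge> 1"
    and "\<alpha> \<in> primitive_part L K q A m" and "\<beta> \<in> primitive_part L K q B n"
  shows "(conjugate_cancellation_for L K q dia m n \<alpha> \<beta> \<longleftrightarrow>
            (\<forall>j < gcd m n.
               generate_field L (K \<union> {\<alpha>, dia \<alpha> (\<beta> [^]\<^bsub>L\<^esub> (q ^ j))}) = generate_field L (K \<union> {\<alpha>, \<beta>}) \<and>
               generate_field L (K \<union> {\<beta>, dia \<alpha> (\<beta> [^]\<^bsub>L\<^esub> (q ^ j))}) = generate_field L (K \<union> {\<alpha>, \<beta>})))
       \<and> (conjugate_cancellation_for L K q dia m n \<alpha> \<beta> \<longleftrightarrow>
            (\<forall>j < gcd m n. \<exists>r \<ge> 1.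
               dia \<alpha> (\<beta> [^]\<^bsub>L\<^esub> (q ^ j)) \<in> primitive_elements L K q r \<and>
               lcm m n = lcm n r \<and> lcm n r = lcm m r))"
proof -
  interpret diamond_pair L K q A B dia m n \<alpha> \<beta>
    using assms
    by (intro diamond_pair.intro finite_field_closure.intro finite_field_closure_axioms.intro
        diamond_pair_axioms.intro)
  show ?thesis
    using cancellation_iff_fields cancellation_iff_lcm by (rule conjI)
qed

end
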